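(* Under the TPE formulation (with the split threshold equal to $f^\star$), the expected improvement is proportional to the probability of improvement as a function of the configuration: $$\mathrm{EI}_{f^\star}[\boldsymbol{x}\mid\mathcal{D}] \;\propto\; \mathbb{P}(f\le f^\star\mid \boldsymbol{x},\mathcal{D}),$$ i.e. there is a positive finite constant $K$, independent of $\boldsymbol{x}$, such that $\mathrm{EI}_{f^\star}[\boldsymbol{x}\mid\mathcal{D}]=K\,\mathbb{P}(f\le f^\star\mid\boldsymbol{x},\mathcal{D})$ for all $\boldsymbol{x}\in\mathcal{X}$.
   Context: Search space: $\mathcal{X}\subseteq\mathbb{R}^D$ is a compact measurable set. $\mathcal{D}$ is a fixed finite set of observations $(\boldsymbol{x}_n,f_n)$ of an objective $f$ on $\mathcal{X}$ (to be minimized), and $f^\star\in\mathbb{R}$ is a fixed threshold. The set $\mathcal{D}$ is split into $\mathcal{D}^{(l)}$ (observations with $f_n\le f^\star$) and $\mathcal{D}^{(g)}$ (observations with $f_n>f^\star$). TPE formulation: $p(\cdot\mid\mathcal{D}^{(l)})$ and $p(\cdot\mid\mathcal{D}^{(g)})$ are probability densities on $\mathcal{X}$ (built by kernel density estimation), and one models $$p(\boldsymbol{x}\mid f,\mathcal{D})=\begin{cases}p(\boldsymbol{x}\mid\mathcal{D}^{(l)}) & (f\le f^\star)\\ p(\boldsymbol{x}\mid\mathcal{D}^{(g)}) & (f>f^\star).\end{cases}$$ Here $p(f\mid\mathcal{D})$ is a probability density of the objective value on $\mathbb{R}$, $p(\boldsymbol{x}\mid\mathcal{D})=\int_{-\infty}^{\infty}p(\boldsymbol{x}\mid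 f,\mathcal{D})\,p(f\mid\mathcal{D})\,df$, and by Bayes' theorem the predictive density is $$p(f\mid\boldsymbol{x},\mathcal{D})=\frac{p(\boldsymbol{x}\mid f,\mathcal{D})\,p(f\mid\mathcal{D})}{p(\boldsymbol{x}\mid\mathcal{D})}.$$ Acquisition functions: $$\mathrm{EI}_{f^\star}[\boldsymbol{x}\mid\mathcal{D}]=\int_{-\infty}^{f^\star}(f^\star-f)\,p(f\mid\boldsymbol{x},\mathcal{D})\,df,\qquad \mathbb{P}(f\le f^\star\mid\boldsymbol{x},\mathcal{D})=\int_{-\infty}^{f^\star}p(f\mid\boldsymbol{x},\mathcal{D})\,df.$$ Standing assumptions: the objective value is integrable, i.e. $\int |f|\,p(f\mid\mathcal{D})\,df<\infty$, and the support of the probability of improvement is all of $\mathcal{X}$, i.e. $\mathbb{P}(f\le f^\star\mid\boldsymbol{x},\mathcal{D})\neq0$ for all $\boldsymbol{x}\in\mathcal{X}$. *)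

theory Defs
  imports "HOL-Analysis.Analysis"
begin

type_synonym 'd observations = "((real ^ 'd) \<times> real) set"

definition pdf_on :: "'a::euclidean_space set \<Rightarrow> ('a \<Rightarrow> real) \<Rightarrow> bool" where
  "pdf_on S p \<longleftrightarrow>
     (\<forall>x\<in>S. 0 \<le> p x) \<and> set_integrable lborel S p \<and> (LINT x:S|lborel. p x) = 1"

definition better_obs :: "real \<Rightarrow> 'd::finite observations \<Rightarrow> 'd observations" where
  "better_obs t D = {(x, y) \<in> D. y \<le> t}"

definition worse_obs :: "real \<Rightarrow> 'd::finite observations \<Rightarrow> 'd observations" where
  "worse_obs t D = {(x, y) \<in> D. y > t}"

text \<open>
  Below, \<open>px S x\<close> is the density \<open>p(x | S)\<close> estimated from the observations \<open>S\<close>, \<open>pf D f\<close> is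
  the density \<open>p(f | D)\<close> of the objective value, and \<open>t\<close> is the split threshold.
  The three functions are \<open>p(x | f, D)\<close>, \<open>p(x | D)\<close> and \<open>p(f | x, D)\<close>, in this order.
\<close>

definition tpe_likelihood ::
  "('d::finite observations \<Rightarrow> real ^ 'd \<Rightarrow> real) \<Rightarrow> real \<Rightarrow> 'd observations
     \<Rightarrow> real \<Rightarrow> real ^ 'd \<Rightarrow> real" where
  "tpe_likelihood px t D f x =
     (if f \<le> t then px (better_obs t D) x else px (worse_obs t D) x)"

definition tpe_marginal ::
  "('d::finite observations \<Rightarrow> real ^ 'd \<Rightarrow> real) \<Rightarrow> ('d observations \<Rightarrow> real \<Rightarrow> real)
     \<Rightarrow> real \<Rightarrow> 'd observations \<Rightarrow> real ^ 'd \<Rightarrow> real" where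
  "tpe_marginal px pf t D x = (LINT f|lborel. tpe_likelihood px t D f x * pf D f)"

definition tpe_predictive ::
  "('d::finite observations \<Rightarrow> real ^ 'd \<Rightarrow> real) \<Rightarrow> ('d observations \<Rightarrow> real \<Rightarrow> real)
     \<Rightarrow> real \<Rightarrow> 'd observations \<Rightarrow> real ^ 'd \<Rightarrow> real \<Rightarrow> real" where
  "tpe_predictive px pf t D x f =
     tpe_likelihood px t D f x * pf D f / tpe_marginal px pf t D x"

text \<open>
  The acquisition functions take an arbitrary predictive density \<open>q x f\<close>, standing for
  \<open>p(f | x, D)\<close>; their threshold \<open>t\<close> is not tied to the split threshold.
\<close>

definition expected_improvement :: "('a \<Rightarrow> real \<Rightarrow> real) \<Rightarrow> real \<Rightarrow> 'a \<Rightarrow> real" where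
  "expected_improvement q t x = (LINT f:{..t}|lborel. (t - f) * q x f)"

definition prob_improvement :: "('a \<Rightarrow> real \<Rightarrow> real) \<Rightarrow> real \<Rightarrow> 'a \<Rightarrow> real" where
  "prob_improvement q t x = (LINT f:{..t}|lborel. q x f)"

end

theory Submission
  imports Defs
begin

text \<open>
  On \<open>f \<le> f\<^sup>*\<close> the predictive density factors as \<open>c(x) p(f | D)\<close>, so \<open>c(x)\<close> scales both
  acquisition functions and their ratio \<open>K\<close> is the ratio of the integrals of
  \<open>(f\<^sup>* - f) p(f | D)\<close> and \<open>p(f | D)\<close> over \<open>f \<le> f\<^sup>*\<close>.  The denominator is nonzero
  because the probability of improvement is; the numerator then is positive because \<open>{f\<^sup>*}\<close> is
  a null set.
\<close>

lemma set_integral_lower_gap_pos: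
  fixes p :: "real \<Rightarrow> real"
  assumes nonneg: "\<And>f. 0 \<le> p f"
    and int: "integrable lborel p"
    and moment: "integrable lborel (\<lambda>f. \<bar>f\<bar> * p f)"
    and mass: "(LINT f:{..t}|lborel. p f) \<noteq> 0"
  shows "0 < (LINT f:{..t}|lborel. (t - f) * p f)"
proof -
  have [measurable]: "p \<in> borel_measurable lborel"
    using int by simp
  \<comment> \<open>The finite first moment enters here. Were the gap integrand not integrable, its
    Bochner integral would default to 0 and positivity would fail.\<close>
  have "integrable lborel (\<lambda>f. f * p f)"
    by (rule Bochner_Integration.integrable_bound[OF moment]) (auto simp: abs_mult)
  then have "integrable lborel (\<lambda>f. t * p f - f * p f)"
    using int by simp
  then have "integrable lborel (\<lambda>f. (t - f) * p f)"
    by (simp add: left_diff_distrib)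
  then have gap: "integrable lborel (\<lambda>f. indicator {..t} f *\<^sub>R ((t - f) * p f))"
    by (intro integrable_mult_indicator) auto
  have gap_nonneg: "0 \<le> indicator {..t} f *\<^sub>R ((t - f) * p f)" for f
    using nonneg[of f] by (auto simp: indicator_def)
  have "(LINT f:{..t}|lborel. (t - f) * p f) \<noteq> 0"
  proof
    assume "(LINT f:{..t}|lborel. (t - f) * p f) = 0"
    then have "AE f in lborel. indicator {..t} f *\<^sub>R ((t - f) * p f) = 0"
      using integral_nonneg_eq_0_iff_AE[OF gap] gap_nonneg
      by (simp add: set_lebesgue_integral_def)
    \<comment> \<open>Away from the single point \<open>t\<close> the factor \<open>t - f\<close> is
      positive on \<open>{..t}\<close>, so it can be cancelled almost everywhere.\<close>
    then have "AE f in lborel. indicator {..t} f *\<^sub>R p f = 0"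
      using AE_lborel_singleton[of t] by eventually_elim (auto simp: indicator_def)
    then have "(LINT f:{..t}|lborel. p f) = 0"
      unfolding set_lebesgue_integral_def by (rule integral_eq_zero_AE)
    with mass show False ..
  qed
  moreover have "0 \<le> (LINT f:{..t}|lborel. (t - f) * p f)"
    unfolding set_lebesgue_integral_def using gap_nonneg by (intro integral_nonneg_AE) auto
  ultimately show ?thesis by simp
qed

lemma tpe_predictive_below:
  "f \<le> t \<Longrightarrow> tpe_predictive px pf t D x f =
     px (better_obs t D) x / tpe_marginal px pf t D x * pf D f"
  by (simp add: tpe_predictive_def tpe_likelihood_def)

text \<open>A constant factor leaves a real Bochner integral unconditionally, and a zero marginal
  makes both sides 0 since \<open>x / 0 = 0\<close>. Hence no side conditions appear.\<close>

lemma prob_improvement_tpe: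
  "prob_improvement (tpe_predictive px pf t D) t x =
     px (better_obs t D) x / tpe_marginal px pf t D x * (LINT f:{..t}|lborel. pf D f)"
proof -
  have "prob_improvement (tpe_predictive px pf t D) t x =
      (LINT f:{..t}|lborel. px (better_obs t D) x / tpe_marginal px pf t D x * pf D f)"
    unfolding prob_improvement_def
    by (intro set_lebesgue_integral_cong) (auto simp: tpe_predictive_below)
  then show ?thesis by (simp only: set_integral_mult_right)
qed

lemma expected_improvement_tpe:
  "expected_improvement (tpe_predictive px pf t D) t x =
     px (better_obs t D) x / tpe_marginal px pf t D x * (LINT f:{..t}|lborel. (t - f) * pf D f)"
proof -
  have "expected_improvement (tpe_predictive px pf t D) t x =
      (LINT f:{..t}|lborel.
        px (better_obs t D) x / tpe_marginal px pf t D x * ((t - f) * pf D f))"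
    unfolding expected_improvement_def
    by (intro set_lebesgue_integral_cong) (auto simp: tpe_predictive_below)
  then show ?thesis by (simp only: set_integral_mult_right)
qed

theorem proposition1:
  fixes X :: "(real ^ 'd::finite) set"
    and D :: "'d observations"
    and fstar :: real
    and px :: "'d observations \<Rightarrow> real ^ 'd \<Rightarrow> real"
    and pf :: "'d observations \<Rightarrow> real \<Rightarrow> real"
  assumes "compact X" and "X \<in> sets lborel"
    and "finite D" and "D \<subseteq> X \<times> UNIV"
    and "pdf_on X (px (better_obs fstar D))"
    and "pdf_on X (px (worse_obs fstar D))"
    and "pdf_on UNIV (pf D)"
    and "integrable lborel (\<lambda>f. \<bar>f\<bar> * pf D f)"
    and "\<forall>x\<in>X. prob_improvement (tpe_predictive px pf fstar D) fstar x \<noteq> 0"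
  shows "\<exists>K::real. K > 0 \<and>
    (\<forall>x\<in>X. expected_improvement (tpe_predictive px pf fstar D) fstar x =
            K * prob_improvement (tpe_predictive px pf fstar D) fstar x)"
proof (cases "X = {}")
  case True
  \<comment> \<open>The claim is vacuous here, so any positive constant serves; the other case
    supplies a point of \<open>X\<close>.\<close>
  then show ?thesis by (intro exI[of _ 1]) simp
next
  case False
  define A where "A = (LINT f:{..fstar}|lborel. pf D f)"
  define B where "B = (LINT f:{..fstar}|lborel. (fstar - f) * pf D f)"
  have nonneg: "0 \<le> pf D f" for f
    using assms(7) by (simp add: pdf_on_def)
  have int: "integrable lborel (pf D)"
    using assms(7) by (simp add: pdf_on_def set_integrable_def)
  \<comment> \<open>At any point of \<open>X\<close> the probability of improvement is a multiple of
    \<open>A\<close>, so it could not be nonzero if \<open>A\<close> were 0.\<close>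
  have "A \<noteq> 0"
    using False assms(9) by (auto simp: A_def prob_improvement_tpe)
  moreover have "0 \<le> A"
    unfolding A_def set_lebesgue_integral_def using nonneg by (intro integral_nonneg_AE) auto
  moreover have "0 < B"
    unfolding B_def using nonneg int assms(8) \<open>A \<noteq> 0\<close>
    by (intro set_integral_lower_gap_pos) (auto simp: A_def)
  ultimately show ?thesis
    by (intro exI[of _ "B / A"])
      (simp add: prob_improvement_tpe expected_improvement_tpe flip: A_def B_def)
qed

end
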